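(* Let $x_n$, $n\in\mathbb{Z}$, be a real sequence satisfying $x_n=0$ for $n<0$ and let $x_0\neq 0$. The $k$-th convolution root $x_n^{*1/k}$, $n\in\mathbb{Z}$, $k\in\mathbb{N}$ (positive integers), is given by $$x_n^{*1/k}=x_0^{1/k}\sum_{j=0}^{n}\binom{1/k}{j}\,\hat{B}_{n,j}(x/x_0),$$ where $x/x_0$ denotes the sequence $\{x_1/x_0,x_2/x_0,\ldots\}$ and the sum is empty (equal to $0$) for $n<0$.
   Context: All sequences are real-valued functions on $\mathbb{Z}$ that vanish for all sufficiently negative indices. The convolution of two such sequences is $(x*y)_n=\sum_{j\in\mathbb{Z}}x_jy_{n-j}$, and $x^{*k}$ is the $k$-fold convolution $x*\cdots*x$. The $k$-th convolution root $x^{*1/k}$ of $x$ is the sequence satisfying $(x^{*1/k})^{*k}=x$. Only real-valued solutions of this equation are considered; the solution is taken to be unique if $k$ is odd and to be the double solution $\pm x^{*1/k}$ if $k$ is even (so for even $k$ one may alternatively define the root as the given expression multiplied by $-1$). In terms of generating functions, $\sum_{n\ge 0}x_n^{*1/k}z^n=\left(\sum_{n\ge 0}x_nz^n\right)^{1/k}$. A power $z^{1/k}$ of a complex number $z$ is defined as $\exp(\ln(z)/k)$, where $\ln$ is a branch of the complex logarithm that is holomorphic on the open disk of radius $|x_0|$ centered at $x_0$. For a sequence $u=\{u_1,u_2,\ldots\}$, the partial ordinary Bell polynomials are $\hat{B}_{n,j}(u)=\sum\frac{j!}{i_1!\cdots i_n!}u_1^{i_1}\cdots u_n^{i_n}$,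 the sum over nonnegative integers with $i_1+\cdots+i_n=j$ and $i_1+2i_2+\cdots+ni_n=n$, with $\hat{B}_{0,0}(u)=1$ and $\hat{B}_{n,0}(u)=0$ for $n\ge1$. Equivalently, $\left(\sum_{m\ge 1}u_mz^m\right)^j=\sum_{n\ge j}\hat{B}_{n,j}(u)z^n$. For real $\alpha$ and integer $j\ge 0$, $\binom{\alpha}{j}=\alpha(\alpha-1)\cdots(\alpha-j+1)/j!$. *)

theory Defs
  imports "HOL-Analysis.Analysis" "HOL-Library.Groups_Big_Fun"
begin

definition left_finite :: "(int \<Rightarrow> real) \<Rightarrow> bool" where
  "left_finite x \<longleftrightarrow> (\<exists>N. \<forall>n<N. x n = 0)"

text \<open>
  For left-finite \<open>x\<close> and \<open>y\<close> only finitely many summands are nonzero, so \<^const>\<open>Sum_any\<close>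
  is the sum over all integers \<open>j\<close>.
\<close>

definition seq_conv :: "(int \<Rightarrow> real) \<Rightarrow> (int \<Rightarrow> real) \<Rightarrow> int \<Rightarrow> real" where
  "seq_conv x y n = Sum_any (\<lambda>j. x j * y (n - j))"

text \<open>The zeroth power is the unit of convolution, so that the first power of \<open>x\<close> is \<open>x\<close>.\<close>

primrec conv_power :: "(int \<Rightarrow> real) \<Rightarrow> nat \<Rightarrow> int \<Rightarrow> real" where
  "conv_power x 0 = (\<lambda>n. if n = 0 then 1 else 0)"
| "conv_power x (Suc k) = seq_conv x (conv_power x k)"

definition is_conv_root :: "nat \<Rightarrow> (int \<Rightarrow> real) \<Rightarrow> (int \<Rightarrow> real) \<Rightarrow> bool" where
  "is_conv_root k x y \<longleftrightarrow> left_finite y \<and> conv_power y k = x"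

text \<open>
  The exponents \<open>i\<^sub>1, \<dots>, i\<^sub>n\<close> are a function on \<open>{1..n}\<close>, and \<open>u\<close> is only used at indices
  at least 1. The index set is finite, since every \<open>i\<^sub>m\<close> is at most \<open>j\<close>. The conventions for
  \<open>n = 0\<close> and for \<open>j = 0\<close> are instances of the formula.
\<close>

definition ordinary_bell :: "nat \<Rightarrow> nat \<Rightarrow> (nat \<Rightarrow> real) \<Rightarrow> real" where
  "ordinary_bell n j u =
     (\<Sum>i \<in> {i \<in> {1..n} \<rightarrow>\<^sub>E (UNIV :: nat set).
               (\<Sum>m=1..n. i m) = j \<and> (\<Sum>m=1..n. m * i m) = n}.
        fact j / (\<Prod>m=1..n. fact (i m)) * (\<Prod>m=1..n. u m ^ i m))"

definition log_branch_on :: "complex set \<Rightarrow> (complex \<Rightarrow> complex) \<Rightarrow> bool" where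
  "log_branch_on S L \<longleftrightarrow> L holomorphic_on S \<and> (\<forall>z\<in>S. exp (L z) = z)"

definition branch_root :: "(complex \<Rightarrow> complex) \<Rightarrow> nat \<Rightarrow> complex \<Rightarrow> complex" where
  "branch_root L k z = exp (L z / of_nat k)"

text \<open>
  The interval \<open>{0..n}\<close> consists of integers, so the sum is empty for negative \<open>n\<close>.
  The value may be non-real, depending on the branch \<open>L\<close>.
\<close>

definition conv_root_formula ::
    "(complex \<Rightarrow> complex) \<Rightarrow> nat \<Rightarrow> (int \<Rightarrow> real) \<Rightarrow> int \<Rightarrow> complex" where
  "conv_root_formula L k x n =
     branch_root L k (of_real (x 0)) *
     of_real (\<Sum>j\<in>{0..n}. ((1 / real k) gchoose nat j) *
                ordinary_bell (nat n) (nat j) (\<lambda>m. x (int m) / x 0))"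

end

theory Submission
  imports Defs "HOL-Computational_Algebra.Formal_Laurent_Series"
begin

text \<open>
  Left-finite sequences are formal Laurent series and convolution is their product. A \<open>k\<close>-th root of
  a series of order 0 has order 0 and is determined by its constant term \<open>c\<close>, a \<open>k\<close>-th root of
  \<open>x\<^sub>0\<close>; writing the series as \<open>x\<^sub>0 (1 + U)\<close>, it is \<open>c\<close> times the binomial series with exponent
  \<open>1/k\<close> composed with \<open>U\<close>. By the multinomial theorem the coefficients of \<open>U\<^sup>j\<close> are the ordinary
  Bell polynomials. Finally, every complex \<open>k\<close>-th root \<open>c\<close> of \<open>x\<^sub>0\<close> is the value of a branch,
  namely of the logarithm \<open>Ln (z / x\<^sub>0) + k Ln c\<close>.
\<close>

section \<open>The multinomial theorem in commutative semirings\<close>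

text \<open>This makes the natural-number quotients that serve as multinomial coefficients below
  exact.\<close>

lemma prod_fact_dvd_fact_sum:
  fixes i :: "'a \<Rightarrow> nat"
  assumes "finite A"
  shows "(\<Prod>m\<in>A. fact (i m)) dvd (fact (\<Sum>m\<in>A. i m) :: nat)"
  using assms
proof (induction A rule: finite_induct)
  case (insert a A)
  have "(\<Prod>m\<in>insert a A. fact (i m)) dvd (fact (i a) * fact (\<Sum>m\<in>A. i m) :: nat)"
    using insert by (simp add: mult_dvd_mono)
  also have "\<dots> dvd fact (\<Sum>m\<in>insert a A. i m)"
    using insert by (simp add: fact_fact_dvd_fact)
  finally show ?case .
qed simp

lemma finite_PiE_sum_eq:
  assumes "finite A"
  shows "finite {i \<in> A \<rightarrow>\<^sub>E (UNIV :: nat set). (\<Sum>m\<in>A. i m) = j}"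
proof (rule finite_subset)
  show "{i \<in> A \<rightarrow>\<^sub>E (UNIV :: nat set). (\<Sum>m\<in>A. i m) = j} \<subseteq> A \<rightarrow>\<^sub>E {..j}"
    using assms by (auto simp: PiE_iff extensional_def intro: member_le_sum)
  show "finite (A \<rightarrow>\<^sub>E {..j})"
    using assms by (simp add: finite_PiE)
qed

text \<open>Induction on \<open>A\<close>: the binomial theorem splits off \<open>f a ^ p\<close>,
  and the induction hypothesis expands the remaining sum to the power \<open>j - p\<close>. The
  coefficient is a \<open>div\<close> of naturals because a semiring has no division.\<close>

theorem multinomial_ring:
  fixes f :: "'a \<Rightarrow> 'b :: comm_semiring_1"
  assumes "finite A"
  shows "(\<Sum>m\<in>A. f m) ^ j =
    (\<Sum>i \<in> {i \<in> A \<rightarrow>\<^sub>E (UNIV :: nat set). (\<Sum>m\<in>A. i m) = j}.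
       of_nat (fact j div (\<Prod>m\<in>A. fact (i m))) * (\<Prod>m\<in>A. f m ^ i m))"
  using assms
proof (induction A arbitrary: j rule: finite_induct)
  case empty
  show ?case by (cases j) auto
next
  case (insert a A)
  define S where "S B j = {i \<in> B \<rightarrow>\<^sub>E (UNIV :: nat set). (\<Sum>m\<in>B. i m) = j}" for B :: "'a set" and j
  define t :: "'a set \<Rightarrow> nat \<Rightarrow> ('a \<Rightarrow> nat) \<Rightarrow> 'b" where
    "t B j i = of_nat (fact j div (\<Prod>m\<in>B. fact (i m))) * (\<Prod>m\<in>B. f m ^ i m)" for B j i
  \<comment> \<open>An exponent function on \<open>insert a A\<close> is its value at
    \<open>a\<close> together with its restriction to \<open>A\<close>. The restriction takes the
    value \<open>undefined\<close> at \<open>a\<close>, as membership in \<open>PiE\<close> demands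
    outside the domain.\<close>
  have S_insert: "i \<in> S (insert a A) j \<longleftrightarrow>
      i a \<le> j \<and> i(a := undefined) \<in> S A (j - i a)" for i
  proof -
    have "(\<Sum>m\<in>A. (i(a := undefined)) m) = (\<Sum>m\<in>A. i m)"
      using insert.hyps by (intro sum.cong) auto
    then show ?thesis
      using insert.hyps by (auto simp: S_def PiE_iff extensional_def)
  qed
  have S_outside: "i(a := undefined) = i" if "i \<in> S A q" for i q
    using that insert.hyps by (auto simp: S_def PiE_iff extensional_def fun_upd_idem)
  have t_insert: "t (insert a A) j (i(a := p)) = of_nat (j choose p) * f a ^ p * t A (j - p) i"
    if p: "p \<le> j" and i: "i \<in> S A (j - p)" for p i
  proof -
    have eq: "(\<Prod>m\<in>A. fact ((i(a := p)) m)) = (\<Prod>m\<in>A. fact (i m) :: nat)"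
      "(\<Prod>m\<in>A. f m ^ (i(a := p)) m) = (\<Prod>m\<in>A. f m ^ i m)"
      using insert.hyps by (auto intro!: prod.cong)
    \<comment> \<open>Here \<open>q\<close> is the multinomial coefficient of the restriction to
      \<open>A\<close>; multiplying it by \<open>j choose p\<close> gives the one for
      \<open>insert a A\<close>.\<close>
    obtain q where q: "(fact (j - p) :: nat) = (\<Prod>m\<in>A. fact (i m)) * q"
      using prod_fact_dvd_fact_sum[OF insert.hyps(1), of i] i by (auto simp: S_def elim: dvdE)
    have "(fact j :: nat) = (fact p * (\<Prod>m\<in>A. fact (i m))) * ((j choose p) * q)"
      using binomial_fact_lemma[OF p] q by (simp add: ac_simps)
    then have "fact j div (fact p * (\<Prod>m\<in>A. fact (i m))) =
        (j choose p) * (fact (j - p) div (\<Prod>m\<in>A. fact (i m) :: nat))"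
      using q insert.hyps by simp
    then show ?thesis
      using insert.hyps eq by (simp add: t_def ac_simps fun_upd_same del: fun_upd_apply)
  qed
  have "(\<Sum>m\<in>insert a A. f m) ^ j =
      (\<Sum>p\<le>j. of_nat (j choose p) * f a ^ p * (\<Sum>i\<in>S A (j - p). t A (j - p) i))"
    using insert by (simp add: binomial_ring S_def t_def)
  also have "\<dots> = (\<Sum>p\<le>j. \<Sum>i\<in>S A (j - p). t (insert a A) j (i(a := p)))"
    by (simp add: sum_distrib_left t_insert)
  also have "\<dots> = (\<Sum>(p, i)\<in>Sigma {..j} (\<lambda>p. S A (j - p)). t (insert a A) j (i(a := p)))"
    using finite_PiE_sum_eq[OF insert.hyps(1)] by (subst sum.Sigma) (auto simp: S_def)
  also have "\<dots> = (\<Sum>i\<in>S (insert a A) j. t (insert a A) j i)"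
  proof (rule sum.reindex_bij_witness[where i = "\<lambda>i. (i a, i(a := undefined))"
        and j = "\<lambda>(p, i). i(a := p)"])
    show "(case pi of (p, i) \<Rightarrow> i(a := p)) \<in> S (insert a A) j"
      if pi: "pi \<in> Sigma {..j} (\<lambda>p. S A (j - p))" for pi
      using pi by (cases pi) (auto simp: S_insert S_outside)
    show "((case pi of (p, i) \<Rightarrow> i(a := p)) a, (case pi of (p, i) \<Rightarrow> i(a := p))(a := undefined)) = pi"
      if pi: "pi \<in> Sigma {..j} (\<lambda>p. S A (j - p))" for pi
      using pi by (cases pi) (auto simp: S_outside)
  qed (auto simp: S_insert)
  finally show ?case by (simp add: S_def t_def)
qed

section \<open>Coefficients of powers of a series and Bell polynomials\<close>

text \<open>Coefficient \<open>n\<close> of a product involves only coefficients up to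
  \<open>n\<close> of its factors. This allows a series to be replaced by a polynomial
  truncation.\<close>

lemma fps_nth_power_cong:
  fixes f g :: "'a :: comm_semiring_1 fps"
  assumes "\<And>m. m \<le> n \<Longrightarrow> fps_nth f m = fps_nth g m"
  shows "fps_nth (f ^ j) n = fps_nth (g ^ j) n"
proof -
  have "\<forall>m\<le>n. fps_nth (f ^ j) m = fps_nth (g ^ j) m"
    by (induction j) (auto simp: fps_mult_nth assms)
  then show ?thesis by simp
qed

text \<open>The truncation \<open>V\<close> of \<open>U\<close> to degrees 1 to \<open>n\<close> is
  a finite sum of monomials, so the multinomial theorem expands \<open>V ^ j\<close>. The term of
  \<open>i\<close> is a monomial of degree \<open>\<Sum>m=1..n. m * i m\<close>; extracting
  coefficient \<open>n\<close> therefore imposes the second condition on the Bell index set.\<close>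

lemma fps_nth_power_eq_ordinary_bell:
  fixes U :: "real fps"
  assumes "fps_nth U 0 = 0"
  shows "fps_nth (U ^ j) n = ordinary_bell n j (fps_nth U)"
proof -
  define V where "V = (\<Sum>m=1..n. fps_const (fps_nth U m) * fps_X ^ m)"
  define S where "S = {i \<in> {1..n} \<rightarrow>\<^sub>E (UNIV :: nat set). (\<Sum>m=1..n. i m) = j}"
  have "fps_nth U m = fps_nth V m" if "m \<le> n" for m
    using that assms by (cases "m = 0") (auto simp: V_def fps_sum_nth if_distrib cong: if_cong)
  then have "fps_nth (U ^ j) n = fps_nth (V ^ j) n"
    by (rule fps_nth_power_cong)
  also have "V ^ j = (\<Sum>i\<in>S. fps_const (of_nat (fact j div (\<Prod>m=1..n. fact (i m)))) *
      (\<Prod>m=1..n. (fps_const (fps_nth U m) * fps_X ^ m) ^ i m))"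
    unfolding V_def S_def by (subst multinomial_ring) (simp_all add: fps_of_nat)
  also have "\<dots> = (\<Sum>i\<in>S. fps_const (of_nat (fact j div (\<Prod>m=1..n. fact (i m))) *
      (\<Prod>m=1..n. fps_nth U m ^ i m)) * fps_X ^ (\<Sum>m=1..n. m * i m))"
  proof (rule sum.cong[OF refl])
    fix i
    have "(\<Prod>m\<in>A. (fps_const (fps_nth U m) * fps_X ^ m) ^ i m) =
        fps_const (\<Prod>m\<in>A. fps_nth U m ^ i m) * fps_X ^ (\<Sum>m\<in>A. m * i m)" if "finite A" for A
      using that
      by (induction A rule: finite_induct)
        (simp_all add: power_mult_distrib fps_const_power power_mult[symmetric] power_add
          flip: fps_const_mult)
    then show "fps_const (of_nat (fact j div (\<Prod>m=1..n. fact (i m)))) *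
        (\<Prod>m=1..n. (fps_const (fps_nth U m) * fps_X ^ m) ^ i m) =
        fps_const (of_nat (fact j div (\<Prod>m=1..n. fact (i m))) *
        (\<Prod>m=1..n. fps_nth U m ^ i m)) * fps_X ^ (\<Sum>m=1..n. m * i m)"
      by (simp add: mult.assoc flip: fps_const_mult)
  qed
  also have "fps_nth \<dots> n = (\<Sum>i\<in>S. if (\<Sum>m=1..n. m * i m) = n then
      fact j / (\<Prod>m=1..n. fact (i m)) * (\<Prod>m=1..n. fps_nth U m ^ i m) else 0)"
    unfolding fps_sum_nth
  proof (rule sum.cong[OF refl])
    fix i assume "i \<in> S"
    then have "real (fact j div (\<Prod>m=1..n. fact (i m))) = fact j / (\<Prod>m=1..n. fact (i m))"
      using prod_fact_dvd_fact_sum[of "{1..n}" i] by (auto simp: S_def real_of_nat_div)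
    then show "fps_nth (fps_const (of_nat (fact j div (\<Prod>m=1..n. fact (i m))) *
        (\<Prod>m=1..n. fps_nth U m ^ i m)) * fps_X ^ (\<Sum>m=1..n. m * i m)) n =
        (if (\<Sum>m=1..n. m * i m) = n then
          fact j / (\<Prod>m=1..n. fact (i m)) * (\<Prod>m=1..n. fps_nth U m ^ i m) else 0)"
      by simp
  qed
  also have "\<dots> = ordinary_bell n j (fps_nth U)"
    unfolding ordinary_bell_def using finite_PiE_sum_eq[of "{1..n}" j]
    by (subst sum.inter_filter[symmetric]) (auto simp: S_def intro!: sum.cong)
  finally show ?thesis .
qed

section \<open>Convolution as multiplication of Laurent series\<close>

lemma seq_conv_fls_nth:
  fixes f g :: "real fls"
  shows "seq_conv (fls_nth f) (fls_nth g) = fls_nth (f * g)"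
proof
  fix n
  have "seq_conv (fls_nth f) (fls_nth g) n =
      (\<Sum>i=fls_subdegree f..n - fls_subdegree g. fls_nth f i * fls_nth g (n - i))"
    unfolding seq_conv_def
  proof (rule Sum_any.expand_superset)
    show "{i. fls_nth f i * fls_nth g (n - i) \<noteq> 0} \<subseteq> {fls_subdegree f..n - fls_subdegree g}"
      using fls_subdegree_leI[of f] fls_subdegree_leI[of g] by force
  qed simp
  also have "\<dots> = fls_nth (f * g) n"
    by (simp add: fls_times_nth(2))
  finally show "seq_conv (fls_nth f) (fls_nth g) n = fls_nth (f * g) n" .
qed

lemma conv_power_fls_nth: "conv_power (fls_nth f) k = fls_nth (f ^ k)"
  by (induction k) (auto simp: seq_conv_fls_nth)

lemma left_finite_iff_fls_nth: "left_finite y \<longleftrightarrow> (\<exists>f. y = fls_nth f)"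
proof
  assume "left_finite y"
  then have "fls_nth (Abs_fls y) = y"
    unfolding left_finite_def by (intro ext nth_Abs_fls_ex_lower_bound)
  then show "\<exists>f. y = fls_nth f" by metis
next
  assume "\<exists>f. y = fls_nth f"
  then show "left_finite y"
    unfolding left_finite_def using fls_eq0_below_subdegree by blast
qed

text \<open>The subdegree of \<open>f ^ k\<close> is \<open>k\<close> times that of
  \<open>f\<close>. Since \<open>X\<close> has subdegree 0, so has every Laurent root, which is
  therefore a power series.\<close>

lemma is_conv_root_iff_fps_root:
  assumes "fps_nth X 0 \<noteq> 0" and "k \<ge> 1"
  shows "is_conv_root k (fls_nth (fps_to_fls X)) y \<longleftrightarrow>
    (\<exists>Y. Y ^ k = X \<and> y = fls_nth (fps_to_fls Y))"
proof
  assume "is_conv_root k (fls_nth (fps_to_fls X)) y"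
  then obtain f where y: "y = fls_nth f" and f: "f ^ k = fps_to_fls X"
    by (auto simp: is_conv_root_def left_finite_iff_fls_nth conv_power_fls_nth fls_nth_inject)
  have "int k * fls_subdegree f = 0"
    using f assms(1) by (simp add: fls_subdegree_pow[symmetric] fls_subdegree_fls_to_fps)
  then have "fps_to_fls (fls_regpart f) = f"
    using assms(2) by simp
  then show "\<exists>Y. Y ^ k = X \<and> y = fls_nth (fps_to_fls Y)"
    using y f by (metis fps_to_fls_power fps_to_fls_eq_iff)
next
  assume "\<exists>Y. Y ^ k = X \<and> y = fls_nth (fps_to_fls Y)"
  then show "is_conv_root k (fls_nth (fps_to_fls X)) y"
    by (auto simp: is_conv_root_def left_finite_iff_fls_nth conv_power_fls_nth fps_to_fls_power)
qed

section \<open>Roots of power series through the binomial series\<close>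

text \<open>Comparing constant terms gives \<open>c ^ k = a\<close> for
  \<open>c = fps_nth Y 0\<close>. A root is determined by its nonzero constant term, and
  \<open>fps_const c * B\<close> is a root with constant term \<open>c\<close>.\<close>

lemma fps_power_eq_iff_binomial:
  fixes U :: "'a :: field_char_0 fps"
  assumes "fps_nth U 0 = 0" and "a \<noteq> 0" and "k \<ge> 1"
  shows "Y ^ k = fps_const a * (1 + U) \<longleftrightarrow>
    (\<exists>c. c ^ k = a \<and> Y = fps_const c * (fps_binomial (1 / of_nat k) oo U))"
proof -
  define B where "B = fps_binomial (1 / of_nat k) oo U"
  have B: "B ^ k = 1 + U" "fps_nth B 0 = 1"
    using assms by (simp_all add: B_def fps_compose_power fps_binomial_power
        fps_binomial_1 fps_compose_add_distrib)
  obtain l where k: "k = Suc l" using assms(3) by (cases k) auto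
  have "Y = fps_const c * B" if "Y ^ k = fps_const a * (1 + U)" and c: "c = fps_nth Y 0" for c
  proof -
    have ca: "c ^ k = a"
      using arg_cong[OF that(1), of "\<lambda>f. fps_nth f 0"] assms(1) c by (simp add: fps_power_zeroth)
    \<comment> \<open>The function argument of \<open>fps_radical\<close> selects the root of the
      constant term; here it always returns \<open>c\<close>. Both \<open>Y\<close> and
      \<open>fps_const c * B\<close> then equal this one radical.\<close>
    have unique: "Z = fps_radical (\<lambda>_ _. c) (Suc l) (fps_const a * (1 + U))"
      if "Z ^ k = fps_const a * (1 + U)" "fps_nth Z 0 = c" for Z
      using that ca assms(1,2) unfolding k
      by (subst radical_unique[symmetric]) auto
    have "(fps_const c * B) ^ k = fps_const a * (1 + U)"
      by (simp add: power_mult_distrib B fps_const_power ca)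
    then show ?thesis
      using unique[of Y] unique[of "fps_const c * B"] that B(2) by simp
  qed
  moreover have "c ^ k = a" if "Y ^ k = fps_const a * (1 + U)" and "c = fps_nth Y 0" for c
    using arg_cong[OF that(1), of "\<lambda>f. fps_nth f 0"] assms(1) that(2)
    by (simp add: fps_power_zeroth)
  ultimately show ?thesis
    unfolding B_def[symmetric] by (auto simp: power_mult_distrib B fps_const_power)
qed

text \<open>The generating function of \<open>s\<close> is the binomial series with exponent
  \<open>1 / k\<close> composed with \<open>U\<close>, the series of \<open>x / x 0\<close> without
  its constant term. The normalization \<open>s 0 = 1\<close> allows \<open>c\<close> to be
  recovered as \<open>y 0\<close>.\<close>

lemma is_conv_root_iff_scaled:
  fixes x :: "int \<Rightarrow> real"
  assumes "\<And>n. n < 0 \<Longrightarrow> x n = 0" and "x 0 \<noteq> 0" and "k \<ge> 1"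
  defines "s \<equiv> \<lambda>n. \<Sum>j\<in>{0..n}. ((1 / real k) gchoose nat j) *
    ordinary_bell (nat n) (nat j) (\<lambda>m. x (int m) / x 0)"
  shows "is_conv_root k x y \<longleftrightarrow> (\<exists>c. c ^ k = x 0 \<and> y = (\<lambda>n. c * s n))"
    and "s 0 = 1"
proof -
  define U where "U = Abs_fps (\<lambda>m. if m = 0 then 0 else x (int m) / x 0)"
  define B where "B = fps_binomial (1 / real k) oo U"
  have U0: "fps_nth U 0 = 0" by (simp add: U_def)
  have x: "x = fls_nth (fps_to_fls (fps_const (x 0) * (1 + U)))"
    using assms(1,2) by (auto simp: fun_eq_iff U_def)
  have bell: "ordinary_bell n j (fps_nth U) = ordinary_bell n j (\<lambda>m. x (int m) / x 0)" for n j
    by (simp add: ordinary_bell_def U_def)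
  have s: "s n = fls_nth (fps_to_fls B) n" for n
  proof (cases "n < 0")
    case False
    then obtain m where n: "n = int m" by (metis int_nat_eq not_less)
    have "fls_nth (fps_to_fls B) n =
        (\<Sum>j=0..m. ((1 / real k) gchoose j) * ordinary_bell m j (\<lambda>m. x (int m) / x 0))"
      by (simp add: n B_def fps_compose_nth fps_nth_power_eq_ordinary_bell U0 bell)
    also have "\<dots> = s n"
      unfolding s_def n
      by (rule sum.reindex_bij_witness[where i = nat and j = int]) auto
    finally show ?thesis ..
  qed (simp add: s_def)
  show "s 0 = 1"
    by (simp add: s B_def)
  have "is_conv_root k x y \<longleftrightarrow> (\<exists>Y. Y ^ k = fps_const (x 0) * (1 + U) \<and> y = fls_nth (fps_to_fls Y))"
    by (subst x, rule is_conv_root_iff_fps_root) (use assms U0 in auto)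
  also have "\<dots> \<longleftrightarrow> (\<exists>c. c ^ k = x 0 \<and> y = fls_nth (fps_to_fls (fps_const c * B)))"
    unfolding B_def using fps_power_eq_iff_binomial[OF U0 assms(2,3)] by auto
  also have "\<dots> \<longleftrightarrow> (\<exists>c. c ^ k = x 0 \<and> y = (\<lambda>n. c * s n))"
    by (simp add: fun_eq_iff s)
  finally show "is_conv_root k x y \<longleftrightarrow> (\<exists>c. c ^ k = x 0 \<and> y = (\<lambda>n. c * s n))" .
qed

section \<open>Logarithm branches and complex roots\<close>

text \<open>On the ball \<open>z / a\<close> has distance less than 1 from 1, hence positive real
  part, and avoids the cut of \<open>Ln\<close>. Adding \<open>w\<close> to
  \<open>Ln (z / a)\<close> gives the prescribed value at \<open>a\<close>.\<close>

lemma log_branch_on_ball_exists: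
  assumes "a \<noteq> 0" and "exp w = a"
  obtains L where "log_branch_on (ball a (norm a)) L" and "L a = w"
proof
  have pos: "Re (z / a) > 0" if "z \<in> ball a (norm a)" for z
  proof -
    have "norm (1 - z / a) < 1"
      using that assms(1) by (simp add: dist_norm norm_divide field_simps flip: diff_divide_distrib)
    then show ?thesis
      using complex_Re_le_cmod[of "1 - z / a"] by simp
  qed
  show "log_branch_on (ball a (norm a)) (\<lambda>z. Ln (z / a) + w)"
    unfolding log_branch_on_def
  proof
    show "(\<lambda>z. Ln (z / a) + w) holomorphic_on ball a (norm a)"
      using pos assms(1)
      by (intro holomorphic_intros) (force simp: complex_nonpos_Reals_iff)+
    show "\<forall>z\<in>ball a (norm a). exp (Ln (z / a) + w) = z"
    proof
      fix z assume "z \<in> ball a (norm a)"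
      then have "z / a \<noteq> 0" using pos by force
      then show "exp (Ln (z / a) + w) = z"
        using assms by (simp add: exp_add)
    qed
  qed
  show "Ln (a / a) + w = w" using assms(1) by simp
qed

lemma branch_root_power_eq:
  assumes "log_branch_on S L" and "z \<in> S" and "k \<ge> 1"
  shows "branch_root L k z ^ k = z"
  using assms by (simp add: branch_root_def log_branch_on_def flip: exp_of_nat_mult)

text \<open>For a root \<open>c\<close>, the number \<open>k * Ln c\<close> is a logarithm of
  \<open>a\<close>; the branch taking this value at \<open>a\<close> yields
  \<open>exp (Ln c) = c\<close>.\<close>

lemma ex_branch_root_eq_iff:
  fixes a c :: complex
  assumes "a \<noteq> 0" and "k \<ge> 1"
  shows "(\<exists>L. log_branch_on (ball a (norm a)) L \<and> branch_root L k a = c) \<longleftrightarrow> c ^ k = a"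
proof
  assume "c ^ k = a"
  then have "exp (of_nat k * Ln c) = a"
    using assms by (subst exp_of_nat_mult) (auto simp: power_0_left)
  then obtain L where "log_branch_on (ball a (norm a)) L" "L a = of_nat k * Ln c"
    using assms log_branch_on_ball_exists by metis
  moreover have "c \<noteq> 0" using \<open>c ^ k = a\<close> assms by (auto simp: power_0_left)
  ultimately show "\<exists>L. log_branch_on (ball a (norm a)) L \<and> branch_root L k a = c"
    using assms(2) by (intro exI[of _ L]) (simp add: branch_root_def)
qed (use assms branch_root_power_eq in auto)

section \<open>Real convolution roots and branch values\<close>

theorem lemma2:
  fixes x :: "int \<Rightarrow> real" and k :: nat
  assumes "\<And>n. n < 0 \<Longrightarrow> x n = 0"
    and "x 0 \<noteq> 0"
    and "k \<ge> 1"
  shows "(\<forall>y. is_conv_root k x y \<longleftrightarrow>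
            (\<exists>L. log_branch_on (ball (complex_of_real (x 0)) \<bar>x 0\<bar>) L \<and>
                 (\<forall>n. complex_of_real (y n) = conv_root_formula L k x n))) \<and>
         (odd k \<longrightarrow> (\<exists>!y. is_conv_root k x y)) \<and>
         (even k \<and> x 0 > 0 \<longrightarrow> (\<exists>y. {y'. is_conv_root k x y'} = {y, \<lambda>n. - y n}))"
proof -
  define s where "s = (\<lambda>n. \<Sum>j\<in>{0..n}. ((1 / real k) gchoose nat j) *
    ordinary_bell (nat n) (nat j) (\<lambda>m. x (int m) / x 0))"
  have root: "is_conv_root k x y \<longleftrightarrow> (\<exists>c. c ^ k = x 0 \<and> y = (\<lambda>n. c * s n))" for y
    unfolding s_def by (rule is_conv_root_iff_scaled(1)) (use assms in auto)
  have s0: "s 0 = 1"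
    unfolding s_def by (rule is_conv_root_iff_scaled(2)) (use assms in auto)
  have formula: "conv_root_formula L k x n = branch_root L k (of_real (x 0)) * of_real (s n)" for L n
    by (simp add: conv_root_formula_def s_def)
  have branch: "(\<exists>L. log_branch_on (ball (complex_of_real (x 0)) \<bar>x 0\<bar>) L \<and>
      branch_root L k (of_real (x 0)) = of_real c) \<longleftrightarrow> c ^ k = x 0" for c
    using ex_branch_root_eq_iff[of "of_real (x 0)" k "of_real c"] assms(2,3)
    by (simp flip: of_real_power)
  \<comment> \<open>The value at \<open>n = 0\<close> forces the branch of the root to be real.\<close>
  have real_branch: "(\<forall>n. complex_of_real (y n) = conv_root_formula L k x n) \<longleftrightarrow>
      (\<exists>c. branch_root L k (of_real (x 0)) = of_real c \<and> y = (\<lambda>n. c * s n))" for y L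
  proof
    assume *: "\<forall>n. complex_of_real (y n) = conv_root_formula L k x n"
    then have "branch_root L k (of_real (x 0)) = of_real (y 0)"
      using s0 by (simp add: formula)
    moreover from this have "complex_of_real (y n) = of_real (y 0 * s n)" for n
      unfolding *[rule_format, of n] formula by simp
    then have "y = (\<lambda>n. y 0 * s n)"
      unfolding of_real_eq_iff by (rule ext)
    ultimately show "\<exists>c. branch_root L k (of_real (x 0)) = of_real c \<and> y = (\<lambda>n. c * s n)"
      by blast
  qed (auto simp: formula)
  \<comment> \<open>Both sides ask for a real \<open>c\<close> with \<open>c ^ k = x 0\<close> and
    \<open>y\<close> equal to \<open>c\<close> times \<open>s\<close>. For even \<open>k\<close> and
    negative \<open>x 0\<close> there is no such \<open>c\<close>, and both are false.\<close>
  have "is_conv_root k x y \<longleftrightarrow>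
      (\<exists>L. log_branch_on (ball (complex_of_real (x 0)) \<bar>x 0\<bar>) L \<and>
         (\<forall>n. complex_of_real (y n) = conv_root_formula L k x n))" for y
    unfolding root real_branch branch[symmetric] by blast
  moreover have "\<exists>!y. is_conv_root k x y" if "odd k"
  proof -
    have "c ^ k = x 0 \<longleftrightarrow> c = root k (x 0)" for c
      using that odd_real_root_unique odd_real_root_pow by metis
    then show ?thesis by (simp add: root)
  qed
  moreover have "\<exists>y. {y'. is_conv_root k x y'} = {y, \<lambda>n. - y n}" if "even k" "x 0 > 0"
  proof -
    have "c ^ k = x 0 \<longleftrightarrow> c = root k (x 0) \<or> c = - root k (x 0)" for c
    proof -
      have "root k (x 0) ^ k = x 0"
        using that assms(3) by simp
      \<comment> \<open>An even power depends only on the absolute value, and powers are injective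
        on nonnegative bases.\<close>
      then have "c ^ k = x 0 \<longleftrightarrow> \<bar>c\<bar> = \<bar>root k (x 0)\<bar>"
        using that assms(3) power_eq_iff_eq_base[of k "\<bar>c\<bar>" "\<bar>root k (x 0)\<bar>"]
        by (simp add: power_even_abs)
      then show ?thesis by (simp add: abs_eq_iff)
    qed
    then have "{y'. is_conv_root k x y'} = {\<lambda>n. root k (x 0) * s n, \<lambda>n. - (root k (x 0) * s n)}"
      by (auto simp: root)
    then show ?thesis by blast
  qed
  ultimately show ?thesis by blast
qed

end
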